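(* Let $d\ge 1$ be an integer. A random $2d$-regular multigraph on $n$ vertices is connected with probability $1-\frac{1}{n^{d-1}}+O\left(\frac{1}{n^{d}}\right)$ as $n\to\infty$.
   Context: A random $2d$-regular multigraph on $n$ vertices is obtained by choosing $d$ permutations $\sigma_1,\dots,\sigma_d$ independently and uniformly at random from $\mathcal{S}_n$ and, starting from $n$ isolated vertices $1,\dots,n$, adding the edge $\{j,\sigma_i(j)\}$ for every $i\in\{1,\dots,d\}$ and $j\in\{1,\dots,n\}$ (loops and multiple edges allowed). *)

theory Defs
  imports
    "HOL-Probability.Product_PMF"
    "HOL-Combinatorics.Permutations"
    "HOL-Library.Landau_Symbols"
    "Graph_Theory.Digraph_Component"
begin

text \<open>
  An undirected multigraph is represented by a multidigraph in which the orientation of the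
  arcs is to be disregarded: the arc \<open>(i, j)\<close> stands for the edge \<open>{j, \<sigma> i j}\<close>. Every pair
  \<open>(i, j)\<close> contributes its own edge, so parallel edges and loops are kept.
  The constant \<^const>\<open>Digraph_Component.connected\<close> is connectedness of the underlying undirected graph
  (not strong connectedness), as the lemma \<open>connected_perm_multigraph_iff\<close> spells out.
  The degree of a vertex is its in-degree plus its out-degree, so that a loop counts twice
  and the degree is always \<open>2 * d\<close> (lemma \<open>degree_perm_multigraph\<close>).
\<close>

definition perm_multigraph ::
    "nat \<Rightarrow> nat \<Rightarrow> (nat \<Rightarrow> nat \<Rightarrow> nat) \<Rightarrow> (nat, nat \<times> nat) pre_digraph" where
  "perm_multigraph d n \<sigma> =
     \<lparr> verts = {1..n}, arcs = {1..d} \<times> {1..n},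
       tail = (\<lambda>(i, j). j), head = (\<lambda>(i, j). \<sigma> i j) \<rparr>"

text \<open>
  The value \<^const>\<open>id\<close> only fills in \<open>\<sigma> i\<close> for \<open>i\<close> outside \<open>{1..d}\<close>, which
  \<^const>\<open>perm_multigraph\<close> ignores on its arcs.
\<close>

definition random_regular_multigraph ::
    "nat \<Rightarrow> nat \<Rightarrow> (nat, nat \<times> nat) pre_digraph pmf" where
  "random_regular_multigraph d n =
     map_pmf (perm_multigraph d n)
       (Pi_pmf {1..d} id (\<lambda>_. pmf_of_set {\<pi>. \<pi> permutes {1..n}}))"

lemma connected_perm_multigraph_iff:
  assumes "\<And>i. i \<in> {1..d} \<Longrightarrow> \<sigma> i permutes {1..n}"
  shows "Digraph_Component.connected (perm_multigraph d n \<sigma>) \<longleftrightarrow>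
    n \<ge> 1 \<and> (\<forall>u\<in>{1..n}. \<forall>v\<in>{1..n}.
      (u, v) \<in> {(x, y). \<exists>i\<in>{1..d}. \<exists>j\<in>{1..n}. {x, y} = {j, \<sigma> i j}}\<^sup>*)"
proof -
  define R where "R = {(x, y). \<exists>i\<in>{1..d}. \<exists>j\<in>{1..n}. {x, y} = {j, \<sigma> i j}}"
  have mem: "\<sigma> i j \<in> {1..n}" if "i \<in> {1..d}" "j \<in> {1..n}" for i j
    using assms[OF that(1)] that(2) permutes_in_image by metis
  let ?H = "with_proj (mk_symmetric (perm_multigraph d n \<sigma>))"
  have V: "verts ?H = {1..n}"
    by (simp add: perm_multigraph_def mk_symmetric_def)
  have A: "arcs_ends ?H = R"
  proof (intro equalityI subsetI)
    fix e assume "e \<in> arcs_ends ?H"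
    then obtain i j where "i \<in> {1..d}" "j \<in> {1..n}" "e = (j, \<sigma> i j) \<or> e = (\<sigma> i j, j)"
      by (auto simp: arcs_ends_def arc_to_ends_def with_proj_def mk_symmetric_def
          perm_multigraph_def)
    moreover from this have "{fst e, snd e} = {j, \<sigma> i j}"
      by auto
    ultimately show "e \<in> R"
      unfolding R_def case_prod_beta mem_Collect_eq by blast
  next
    fix e assume "e \<in> R"
    then obtain i j where ij: "i \<in> {1..d}" "j \<in> {1..n}" "e = (j, \<sigma> i j) \<or> e = (\<sigma> i j, j)"
      unfolding R_def by (auto simp: doubleton_eq_iff)
    then have "(i, j) \<in> arcs (perm_multigraph d n \<sigma>)"
      by (simp add: perm_multigraph_def)
    moreover have "e \<in> {(j, \<sigma> i j), (\<sigma> i j, j)}"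
      using ij(3) by simp
    ultimately have "e \<in> parcs (mk_symmetric (perm_multigraph d n \<sigma>))"
      unfolding mk_symmetric_def by (fastforce simp: perm_multigraph_def)
    then show "e \<in> arcs_ends ?H"
      by (simp add: arcs_ends_def arc_to_ends_def with_proj_def)
  qed
  have "u \<rightarrow>\<^sup>*\<^bsub>?H\<^esub> v \<longleftrightarrow> (u, v) \<in> R\<^sup>*" if "u \<in> {1..n}" for u v
  proof
    assume "u \<rightarrow>\<^sup>*\<^bsub>?H\<^esub> v"
    then show "(u, v) \<in> R\<^sup>*"
      unfolding reachable_def A by (rule rtrancl_on_rtranclI)
  next
    assume "(u, v) \<in> R\<^sup>*"
    then show "u \<rightarrow>\<^sup>*\<^bsub>?H\<^esub> v"
      unfolding reachable_def A V
    proof induction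
      case base
      then show ?case using that by (rule rtrancl_on_refl)
    next
      case (step y z)
      then show ?case using mem
        by (intro rtrancl_on_into_rtrancl_on[OF step.IH]) (auto simp: R_def doubleton_eq_iff)
    qed
  qed
  then show ?thesis
    unfolding Digraph_Component.connected_def strongly_connected_def V R_def[symmetric]
    by auto
qed

lemma degree_perm_multigraph:
  assumes "\<And>i. i \<in> {1..d} \<Longrightarrow> \<sigma> i permutes {1..n}" and v: "v \<in> {1..n}"
  shows "in_degree (perm_multigraph d n \<sigma>) v + out_degree (perm_multigraph d n \<sigma>) v = 2 * d"
proof -
  let ?G = "perm_multigraph d n \<sigma>"
  have "out_arcs ?G v = (\<lambda>i. (i, v)) ` {1..d}"
    using v by (auto simp: out_arcs_def perm_multigraph_def)
  then have out: "out_degree ?G v = d"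
    by (simp add: out_degree_def card_image inj_on_def)
  have "in_arcs ?G v = (\<lambda>i. (i, inv (\<sigma> i) v)) ` {1..d}"
  proof (intro equalityI subsetI)
    fix e assume "e \<in> in_arcs ?G v"
    then obtain i j where e: "e = (i, j)" "i \<in> {1..d}" "\<sigma> i j = v"
      by (auto simp: in_arcs_def perm_multigraph_def)
    have "inv (\<sigma> i) v = j"
      using permutes_inverses(2)[OF assms(1)[OF e(2)], of j] e(3) by simp
    with e show "e \<in> (\<lambda>i. (i, inv (\<sigma> i) v)) ` {1..d}" by (auto simp: image_iff)
  next
    fix e assume "e \<in> (\<lambda>i. (i, inv (\<sigma> i) v)) ` {1..d}"
    then obtain i where i: "e = (i, inv (\<sigma> i) v)" "i \<in> {1..d}" by blast
    have "inv (\<sigma> i) v \<in> {1..n}"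
      using permutes_in_image[OF permutes_inv[OF assms(1)[OF i(2)]], of v] v by simp
    moreover have "\<sigma> i (inv (\<sigma> i) v) = v"
      using permutes_inverses(1)[OF assms(1)[OF i(2)]] .
    ultimately show "e \<in> in_arcs ?G v"
      using i by (simp add: in_arcs_def perm_multigraph_def)
  qed
  then have "in_degree ?G v = d"
    by (simp add: in_degree_def card_image inj_on_def)
  with out show ?thesis by simp
qed

end

theory Submission
  imports Defs "HOL-Combinatorics.Cycles" "HOL-Combinatorics.Orbits"
    "HOL-Combinatorics.Multiset_Permutations"
begin

text \<open>
  The multigraph is disconnected iff some proper nonempty vertex set is invariant under all \<open>d\<close>
  permutations, and a fixed \<open>k\<close>-set is invariant with probability \<open>(n choose k)^(-d)\<close>. For
  \<open>d \<ge> 2\<close> the union bound over \<open>k \<le> n/2\<close> gives \<open>1/n^(d-1)\<close> from \<open>k = 1\<close> plus \<open>O(1/n^d)\<close> from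
  the larger sets; pairs of isolated vertices are rare enough that the first term is attained. For
  \<open>d = 1\<close> a connected graph is a single cycle, which has probability \<open>1/n\<close>.
\<close>

section \<open>Permutations that preserve or fix given points: counts and probabilities\<close>

lemma perm_restrict_permutes:
  assumes "\<pi> permutes V" "\<pi> ` S = S"
  shows "perm_restrict \<pi> S permutes S"
proof -
  have "bij_betw \<pi> S S"
    using assms permutes_inj_on[OF assms(1)] by (simp add: bij_betw_def)
  then have "bij_betw (perm_restrict \<pi> S) S S"
    by (rule bij_betw_cong[THEN iffD1, rotated]) (simp add: perm_restrict_simps)
  then show ?thesis
    by (rule bij_imp_permutes) (simp add: perm_restrict_simps)
qed

lemma permutes_image_compl:
  assumes "\<pi> permutes V" "\<pi> ` S = S"
  shows "\<pi> ` (V - S) = V - S"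
  using assms permutes_image[OF assms(1)] permutes_inj[OF assms(1)]
  by (simp add: image_set_diff)

text \<open>A permutation of \<open>V\<close> that preserves \<open>S\<close> splits uniquely into a
  permutation of \<open>S\<close> composed with one of \<open>V - S\<close>. Composition is
  therefore a bijection from such pairs onto the set counted here.\<close>

lemma card_permutes_invariant:
  assumes V: "finite V" and S: "S \<subseteq> V"
  shows "card {\<pi>. \<pi> permutes V \<and> \<pi> ` S = S} = fact (card S) * fact (card V - card S)"
proof -
  let ?P = "{p. p permutes S}" and ?Q = "{q. q permutes V - S}"
  have fin: "finite S" using assms finite_subset by blast
  have on_S: "(p \<circ> q) x = p x" if "q permutes V - S" "x \<in> S" for p q :: "'a \<Rightarrow> 'a" and x
    using that by (simp add: permutes_not_in)
  have off_S: "(p \<circ> q) x = q x" if "p permutes S" "q permutes V - S" "x \<notin> S"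
    for p q :: "'a \<Rightarrow> 'a" and x
  proof -
    \<comment> \<open>Either \<open>x\<close> lies in \<open>V - S\<close>, which \<open>q\<close>
      preserves, or \<open>x\<close> lies outside \<open>V\<close> and \<open>q\<close> fixes
      it.\<close>
    have "q x \<notin> S"
      using that permutes_in_image[OF that(2), of x] permutes_not_in[OF that(2), of x] by auto
    then show ?thesis using that(1) by (simp add: permutes_not_in)
  qed
  have "inj_on (\<lambda>(p, q). p \<circ> q) (?P \<times> ?Q)"
  proof (intro inj_onI, clarify)
    fix p q p' q' :: "'a \<Rightarrow> 'a"
    assume *: "p permutes S" "q permutes V - S" "p' permutes S" "q' permutes V - S"
      and eq: "p \<circ> q = p' \<circ> q'"
    have "p x = p' x" for x
      using on_S[OF *(2), of x p] on_S[OF *(4), of x p'] eq *(1,3)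
      by (cases "x \<in> S") (auto simp: permutes_not_in)
    moreover have "q x = q' x" for x
      using off_S[OF *(1,2), of x] off_S[OF *(3,4), of x] eq *(2,4)
      by (cases "x \<in> S") (auto simp: permutes_not_in)
    ultimately show "p = p' \<and> q = q'" by auto
  qed
  moreover have "(\<lambda>(p, q). p \<circ> q) ` (?P \<times> ?Q) = {\<pi>. \<pi> permutes V \<and> \<pi> ` S = S}"
  proof (intro equalityI subsetI)
    fix \<pi> assume "\<pi> \<in> (\<lambda>(p, q). p \<circ> q) ` (?P \<times> ?Q)"
    then obtain p q where *: "p permutes S" "q permutes V - S" "\<pi> = p \<circ> q" by auto
    have "\<pi> permutes V"
      unfolding *(3) using *(1,2) S
      by (intro permutes_compose) (auto intro: permutes_subset)
    moreover have "\<pi> ` S = p ` S"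
      unfolding *(3) by (intro image_cong refl on_S[OF *(2)])
    ultimately show "\<pi> \<in> {\<pi>. \<pi> permutes V \<and> \<pi> ` S = S}"
      using permutes_image[OF *(1)] by simp
  next
    fix \<pi> assume "\<pi> \<in> {\<pi>. \<pi> permutes V \<and> \<pi> ` S = S}"
    then have *: "\<pi> permutes V" "\<pi> ` S = S" by auto
    have p: "perm_restrict \<pi> S permutes S"
      using * by (rule perm_restrict_permutes)
    have q: "perm_restrict \<pi> (V - S) permutes V - S"
      using *(1) permutes_image_compl[OF *] by (rule perm_restrict_permutes)
    have "perm_restrict \<pi> S \<circ> perm_restrict \<pi> (V - S) = perm_restrict \<pi> (S \<union> (V - S))"
      using p q by (rule perm_restrict_union) auto
    also have "\<dots> = \<pi>"
      using S *(1) by (simp add: Un_absorb1)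
    finally have "\<pi> = (\<lambda>(p, q). p \<circ> q) (perm_restrict \<pi> S, perm_restrict \<pi> (V - S))"
      by simp
    then show "\<pi> \<in> (\<lambda>(p, q). p \<circ> q) ` (?P \<times> ?Q)"
      using p q by blast
  qed
  ultimately have "card {\<pi>. \<pi> permutes V \<and> \<pi> ` S = S} = card (?P \<times> ?Q)"
    by (simp only: card_image[symmetric])
  also have "\<dots> = fact (card S) * fact (card V - card S)"
    using V S fin by (simp add: card_cartesian_product card_permutations card_Diff_subset)
  finally show ?thesis .
qed

lemma prob_pmf_of_set_permutes:
  assumes "finite V"
  shows "measure_pmf.prob (pmf_of_set {\<pi>. \<pi> permutes V}) A =
    card {\<pi>. \<pi> permutes V \<and> \<pi> \<in> A} / fact (card V)"
proof -
  have "{\<pi>. \<pi> permutes V} \<noteq> {}"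
    using permutes_id by blast
  moreover have "{\<pi>. \<pi> permutes V} \<inter> A = {\<pi>. \<pi> permutes V \<and> \<pi> \<in> A}"
    by blast
  ultimately show ?thesis
    using assms by (simp add: measure_pmf_of_set finite_permutations card_permutations)
qed

text \<open>The count gives k! (m - k)! / m! with k = \<open>card S\<close> and m =
  \<open>card V\<close>. Equivalently, the image of a fixed k-set under a uniform permutation is
  uniform among all k-subsets.\<close>

lemma prob_permutes_invariant:
  assumes "finite V" "S \<subseteq> V"
  shows "measure_pmf.prob (pmf_of_set {\<pi>. \<pi> permutes V}) {\<pi>. \<pi> ` S = S} =
    1 / (card V choose card S)"
proof -
  have "card S \<le> card V" using assms by (rule card_mono)
  then show ?thesis
    using assms by (simp add: prob_pmf_of_set_permutes card_permutes_invariant binomial_fact)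
qed

text \<open>Permutations fixing both points are exactly the permutations of the remaining m - 2
  points, where m = \<open>card V\<close>, so the ratio is (m - 2)! / m!. This gives the correction
  term for pairs of isolated vertices in the lower bound.\<close>

lemma prob_permutes_fix_two:
  assumes "finite V" "x \<in> V" "y \<in> V" "x \<noteq> y"
  shows "measure_pmf.prob (pmf_of_set {\<pi>. \<pi> permutes V}) {\<pi>. \<pi> x = x \<and> \<pi> y = y} =
    1 / (real (card V) * (real (card V) - 1))"
proof -
  have "{\<pi>. \<pi> permutes V \<and> \<pi> \<in> {\<pi>. \<pi> x = x \<and> \<pi> y = y}} = {\<pi>. \<pi> permutes V - {x, y}}"
    using assms by (auto intro: permutes_subset permutes_superset simp: permutes_not_in)
  moreover have "card (V - {x, y}) = card V - 2"
    using assms by (subst card_Diff_subset) auto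
  moreover have "card {x, y} \<le> card V"
    using assms by (intro card_mono) auto
  then obtain m where "card V = Suc (Suc m)"
    using assms(4) by (auto dest!: le_Suc_ex)
  then have "(fact (card V) :: real) = real (card V) * (real (card V) - 1) * fact (card V - 2)"
    by (simp add: algebra_simps)
  ultimately show ?thesis
    using assms(1) by (simp add: prob_pmf_of_set_permutes card_permutations)
qed

section \<open>Counting transitive permutations\<close>

text \<open>Transitive permutations are cycles, and a cycle can be written starting from a given point.\<close>

lemma card_transitive_permutes_le:
  assumes V: "finite V" "V \<noteq> {}"
  shows "card {\<pi>. \<pi> permutes V \<and> (\<forall>S\<subseteq>V. \<pi> ` S = S \<longrightarrow> S = {} \<or> S = V)} \<le> fact (card V - 1)"
    (is "card ?T \<le> _")
proof -
  obtain a where a: "a \<in> V" using V by blast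
  \<comment> \<open>Fixing the first entry \<open>a\<close> of the cycle leaves only the order of
    the other points to choose, which accounts for the factorial of
    \<open>card V - 1\<close>.\<close>
  have "?T \<subseteq> (\<lambda>ys. cycle_of_list (a # ys)) ` permutations_of_set (V - {a})"
  proof
    fix \<pi> assume "\<pi> \<in> ?T"
    then have p: "\<pi> permutes V"
      and trans: "\<And>S. S \<subseteq> V \<Longrightarrow> \<pi> ` S = S \<Longrightarrow> S = {} \<or> S = V" by auto
    have perm: "permutation \<pi>"
      using V p permutation_permutes by blast
    \<comment> \<open>The list of iterates of \<open>a\<close> up to its least period. Its set is
      the orbit of \<open>a\<close>, a nonempty invariant set, so transitivity forces it to be all
      of \<open>V\<close>.\<close>
    let ?c = "support \<pi> a"
    have orb: "set ?c = range (\<lambda>i. (\<pi> ^^ i) a)"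
      by (rule support_set[OF perm])
    have sub: "set ?c \<subseteq> V"
      unfolding orb using permutes_in_image[OF permutes_funpow[OF p]] a by auto
    have "\<pi> ` set ?c \<subseteq> set ?c"
      unfolding orb image_image by (auto intro: range_eqI[where x = "Suc _"])
    then have "\<pi> ` set ?c = set ?c"
      using permutes_inj_on[OF p] by (intro endo_inj_surj) auto
    moreover have "set ?c \<noteq> {}" unfolding orb by simp
    ultimately have c: "set ?c = V" using trans[OF sub] by blast
    have "\<pi> x = cycle_of_list ?c x" for x
    proof (cases "x \<in> V")
      case True
      then show ?thesis using cycle_restrict[OF perm, of x a] c by simp
    next
      case False
      then show ?thesis using id_outside_supp[of x ?c] c permutes_not_in[OF p] by simp
    qed
    then have \<pi>: "\<pi> = cycle_of_list ?c" by blast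
    \<comment> \<open>The period is positive, so the list of iterates is nonempty and begins with
      the zeroth iterate \<open>a\<close>.\<close>
    obtain m where m: "least_power \<pi> a = Suc m"
      using least_power_of_permutation(2)[OF perm, of a] gr0_conv_Suc by blast
    obtain ys where ys: "?c = a # ys"
      unfolding m upt_conv_Cons[OF zero_less_Suc] by simp
    have "distinct (a # ys)"
      using cycle_of_permutation[OF perm, of a] ys by simp
    then have "ys \<in> permutations_of_set (V - {a})"
      using c ys by (intro permutations_of_setI) auto
    then show "\<pi> \<in> (\<lambda>ys. cycle_of_list (a # ys)) ` permutations_of_set (V - {a})"
      using \<pi> ys by auto
  qed
  then have "card ?T \<le> card (permutations_of_set (V - {a}))"
    using V by (intro surj_card_le) auto
  also have "\<dots> = fact (card V - 1)"
    using V a by simp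
  finally show ?thesis .
qed

section \<open>Connectedness in terms of invariant vertex sets\<close>

text \<open>No edge leaves an invariant set, and conversely the component of a vertex is invariant.
  This replaces reachability by a condition imposed on each permutation separately, which
  independence can exploit.\<close>

lemma connected_perm_multigraph_iff_invariant:
  assumes \<sigma>: "\<And>i. i \<in> {1..d} \<Longrightarrow> \<sigma> i permutes {1..n}"
  shows "Digraph_Component.connected (perm_multigraph d n \<sigma>) \<longleftrightarrow>
    n \<ge> 1 \<and> (\<forall>S\<subseteq>{1..n}. (\<forall>i\<in>{1..d}. \<sigma> i ` S = S) \<longrightarrow> S = {} \<or> S = {1..n})"
proof -
  let ?V = "{1..n}"
  define R where "R = {(x, y). \<exists>i\<in>{1..d}. \<exists>j\<in>?V. {x, y} = {j, \<sigma> i j}}"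
  have conn: "Digraph_Component.connected (perm_multigraph d n \<sigma>) \<longleftrightarrow>
      n \<ge> 1 \<and> (\<forall>u\<in>?V. \<forall>v\<in>?V. (u, v) \<in> R\<^sup>*)"
    unfolding R_def by (rule connected_perm_multigraph_iff[OF \<sigma>])
  have "(\<forall>u\<in>?V. \<forall>v\<in>?V. (u, v) \<in> R\<^sup>*) \<longleftrightarrow>
    (\<forall>S\<subseteq>?V. (\<forall>i\<in>{1..d}. \<sigma> i ` S = S) \<longrightarrow> S = {} \<or> S = ?V)"
  proof safe
    fix S x y
    assume reach: "\<forall>u\<in>?V. \<forall>v\<in>?V. (u, v) \<in> R\<^sup>*" and S: "S \<subseteq> ?V"
      and inv: "\<forall>i\<in>{1..d}. \<sigma> i ` S = S" and x: "x \<in> ?V" "x \<notin> S" and y: "y \<in> S"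
    have "(y, x) \<in> R\<^sup>*" using reach S x y by blast
    then have "x \<in> S"
    proof induction
      case (step b c)
      then obtain i j where ij: "i \<in> {1..d}" "{b, c} = {j, \<sigma> i j}" unfolding R_def by auto
      \<comment> \<open>Paths may traverse an edge in either direction, so an equivalence is
        required; its backward half uses injectivity of \<open>\<sigma> i\<close>.\<close>
      have "\<sigma> i j \<in> S \<longleftrightarrow> j \<in> S"
        using inv ij(1) inj_image_mem_iff[OF permutes_inj[OF \<sigma>[OF ij(1)]], of j S] by auto
      with ij(2) step.IH show ?case by (auto simp: doubleton_eq_iff)
    qed (fact y)
    with x show "y \<in> {}" by blast
  next
    fix u v
    assume triv: "\<forall>S\<subseteq>?V. (\<forall>i\<in>{1..d}. \<sigma> i ` S = S) \<longrightarrow> S = {} \<or> S = ?V"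
      and u: "u \<in> ?V" and v: "v \<in> ?V"
    \<comment> \<open>The component of \<open>u\<close>. Each \<open>\<sigma> i\<close> maps it into
      itself, and injectivity on a finite set upgrades this to equality.\<close>
    let ?S = "{w \<in> ?V. (u, w) \<in> R\<^sup>*}"
    have "\<sigma> i ` ?S = ?S" if i: "i \<in> {1..d}" for i
    proof (rule endo_inj_surj)
      show "\<sigma> i ` ?S \<subseteq> ?S"
      proof
        fix z assume "z \<in> \<sigma> i ` ?S"
        then obtain w where w: "w \<in> ?V" "(u, w) \<in> R\<^sup>*" "z = \<sigma> i w" by blast
        then have "(w, z) \<in> R" using i unfolding R_def by blast
        moreover have "z \<in> ?V"
          using w permutes_in_image[OF \<sigma>[OF i], of w] by blast
        ultimately show "z \<in> ?S" using w by auto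
      qed
    qed (use permutes_inj_on[OF \<sigma>[OF i]] in auto)
    then have "?S = {} \<or> ?S = ?V" using triv by (metis (no_types, lifting) mem_Collect_eq subsetI)
    then show "(u, v) \<in> R\<^sup>*" using u v by blast
  qed
  then show ?thesis using conn by simp
qed

section \<open>The random tuple of permutations\<close>

text \<open>The law of the tuple before it is turned into a multigraph. Events about individual
  permutations, such as the invariance of a set, are directly expressible at this level.\<close>

definition random_permutations :: "nat \<Rightarrow> nat \<Rightarrow> (nat \<Rightarrow> nat \<Rightarrow> nat) pmf" where
  "random_permutations d n = Pi_pmf {1..d} id (\<lambda>_. pmf_of_set {\<pi>. \<pi> permutes {1..n}})"

lemma permutes_random_permutations:
  assumes "\<sigma> \<in> set_pmf (random_permutations d n)" "i \<in> {1..d}"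
  shows "\<sigma> i permutes {1..n}"
proof -
  have "{\<pi>. \<pi> permutes {1..n}} \<noteq> {}" using permutes_id by blast
  then show ?thesis
    using assms set_Pi_pmf[of "{1..d}" id "\<lambda>_. pmf_of_set {\<pi>. \<pi> permutes {1..n}}"]
    by (auto simp: random_permutations_def PiE_dflt_def finite_permutations)
qed

text \<open>Independence of the coordinates turns the probability into a product of \<open>d\<close>
  equal factors.\<close>

lemma prob_random_permutations_all:
  "measure_pmf.prob (random_permutations d n) {\<sigma>. \<forall>i\<in>{1..d}. \<sigma> i \<in> A} =
    measure_pmf.prob (pmf_of_set {\<pi>. \<pi> permutes {1..n}}) A ^ d"
proof -
  have "{\<sigma>. \<forall>i\<in>{1..d}. \<sigma> i \<in> A} = Pi {1..d} (\<lambda>_. A)"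
    by auto
  then show ?thesis
    unfolding random_permutations_def by (simp add: measure_Pi_pmf_Pi)
qed

definition disconnecting :: "nat \<Rightarrow> nat \<Rightarrow> (nat \<Rightarrow> nat \<Rightarrow> nat) set" where
  "disconnecting d n = {\<sigma>. \<not> Digraph_Component.connected (perm_multigraph d n \<sigma>)}"

lemma prob_connected_eq:
  "measure_pmf.prob (random_regular_multigraph d n) {G. Digraph_Component.connected G} =
    1 - measure_pmf.prob (random_permutations d n) (disconnecting d n)"
proof -
  have "perm_multigraph d n -` {G. Digraph_Component.connected G} = UNIV - disconnecting d n"
    by (auto simp: disconnecting_def)
  then show ?thesis
    unfolding random_regular_multigraph_def random_permutations_def
    by (simp add: measure_pmf.prob_compl[simplified])
qed

section \<open>The case of a single permutation\<close>

text \<open>For \<open>d = 1\<close> the main term 1 - 1/n^0 vanishes, so an upper bound of order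
  1/n is all that the asymptotic claim asks for. It comes from at most (n - 1)! transitive
  permutations among n!.\<close>

lemma prob_connected_one_le:
  assumes "n \<ge> 1"
  shows "measure_pmf.prob (random_regular_multigraph 1 n) {G. Digraph_Component.connected G} \<le> 1 / real n"
proof -
  let ?T = "{\<pi>. \<forall>S\<subseteq>{1..n}. \<pi> ` S = S \<longrightarrow> S = {} \<or> S = {1..n}}"
  have "measure_pmf.prob (random_regular_multigraph 1 n) {G. Digraph_Component.connected G} =
      measure_pmf.prob (random_permutations 1 n) {\<sigma>. Digraph_Component.connected (perm_multigraph 1 n \<sigma>)}"
    unfolding random_regular_multigraph_def random_permutations_def by simp
  \<comment> \<open>The inclusion of events is shown on the support only, where every
    \<open>\<sigma> i\<close> is a permutation and the invariant-set criterion applies.\<close>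
  also have "\<dots> \<le> measure_pmf.prob (random_permutations 1 n) {\<sigma>. \<forall>i\<in>{1..1}. \<sigma> i \<in> ?T}"
  proof (intro measure_pmf.finite_measure_mono_AE AE_pmfI impI)
    fix \<sigma> assume s: "\<sigma> \<in> set_pmf (random_permutations 1 n)"
      and "\<sigma> \<in> {\<sigma>. Digraph_Component.connected (perm_multigraph 1 n \<sigma>)}"
    then show "\<sigma> \<in> {\<sigma>. \<forall>i\<in>{1..1}. \<sigma> i \<in> ?T}"
      using connected_perm_multigraph_iff_invariant[OF permutes_random_permutations[OF s]] by simp
  qed simp
  also have "\<dots> = measure_pmf.prob (pmf_of_set {\<pi>. \<pi> permutes {1..n}}) ?T"
    by (subst prob_random_permutations_all) simp
  also have "\<dots> \<le> fact (n - 1) / fact n"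
  proof -
    have "card {\<pi>. \<pi> permutes {1..n} \<and> \<pi> \<in> ?T} \<le> fact (n - 1)"
      using card_transitive_permutes_le[of "{1..n}"] assms by simp
    then have "real (card {\<pi>. \<pi> permutes {1..n} \<and> \<pi> \<in> ?T}) \<le> fact (n - 1)"
      using of_nat_mono by fastforce
    then show ?thesis
      by (subst prob_pmf_of_set_permutes) (simp_all add: divide_right_mono)
  qed
  also have "\<dots> = 1 / real n"
    using assms by (cases n) auto
  finally show ?thesis .
qed

section \<open>Upper bound on the probability of disconnection\<close>

text \<open>A set or its complement has at most half the vertices, so only small invariant sets are needed.\<close>

lemma small_invariant_set_if_disconnecting:
  assumes \<sigma>: "\<And>i. i \<in> {1..d} \<Longrightarrow> \<sigma> i permutes {1..n}" and "n \<ge> 1" "\<sigma> \<in> disconnecting d n"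
  obtains S where "S \<subseteq> {1..n}" "card S \<in> {1..n div 2}" "\<And>i. i \<in> {1..d} \<Longrightarrow> \<sigma> i ` S = S"
proof -
  obtain S where S: "S \<subseteq> {1..n}" "S \<noteq> {}" "S \<noteq> {1..n}" "\<And>i. i \<in> {1..d} \<Longrightarrow> \<sigma> i ` S = S"
    using assms(2,3) connected_perm_multigraph_iff_invariant[of d \<sigma> n, OF \<sigma>]
    unfolding disconnecting_def mem_Collect_eq by blast
  have fin: "finite S" using S(1) finite_subset by blast
  have card: "card ({1..n} - S) = n - card S"
    using S(1) fin by (simp add: card_Diff_subset)
  \<comment> \<open>Properness of \<open>S\<close> makes its complement nonempty, as needed when the
    complement takes the place of \<open>S\<close>.\<close>
  have "card S < n"
    using psubset_card_mono[of "{1..n}" S] S by auto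
  show thesis
  proof (cases "card S \<le> n div 2")
    case True
    moreover have "card S \<ge> 1" using S fin by (simp add: Suc_le_eq card_gt_0_iff)
    ultimately show ?thesis using S that[of S] by auto
  next
    case False
    then have "card ({1..n} - S) \<in> {1..n div 2}"
      using card \<open>card S < n\<close> by auto
    then show ?thesis
      using that[of "{1..n} - S"] permutes_image_compl[OF \<sigma> S(4)] by blast
  qed
qed

text \<open>Union bound, first over sizes and then over sets. The factor \<open>n choose k\<close>
  counts the sets of size \<open>k\<close>; the power is the probability that all \<open>d\<close>
  permutations preserve a given one.\<close>

lemma prob_disconnecting_le:
  assumes "n \<ge> 1"
  shows "measure_pmf.prob (random_permutations d n) (disconnecting d n) \<le>
    (\<Sum>k\<in>{1..n div 2}. (n choose k) * (1 / (n choose k)) ^ d)"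
proof -
  let ?M = "random_permutations d n"
  let ?E = "\<lambda>S. {\<sigma>. \<forall>i\<in>{1..d}. \<sigma> i \<in> {\<pi>. \<pi> ` S = S}}"
  let ?C = "\<lambda>k. {S. S \<subseteq> {1..n} \<and> card S = k}"
  have "measure_pmf.prob ?M (disconnecting d n) \<le>
      measure_pmf.prob ?M (\<Union>k\<in>{1..n div 2}. \<Union>S\<in>?C k. ?E S)"
  proof (intro measure_pmf.finite_measure_mono_AE)
    show "AE \<sigma> in ?M. \<sigma> \<in> disconnecting d n \<longrightarrow> \<sigma> \<in> (\<Union>k\<in>{1..n div 2}. \<Union>S\<in>?C k. ?E S)"
    proof (intro AE_pmfI impI)
      fix \<sigma> assume s: "\<sigma> \<in> set_pmf ?M" and disc: "\<sigma> \<in> disconnecting d n"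
      obtain S where "S \<subseteq> {1..n}" "card S \<in> {1..n div 2}" "\<And>i. i \<in> {1..d} \<Longrightarrow> \<sigma> i ` S = S"
        using small_invariant_set_if_disconnecting[OF permutes_random_permutations[OF s] assms disc]
        by blast
      then show "\<sigma> \<in> (\<Union>k\<in>{1..n div 2}. \<Union>S\<in>?C k. ?E S)"
        by (intro UN_I[of "card S"] UN_I[of S]) auto
    qed
  qed simp
  also have "\<dots> \<le> (\<Sum>k\<in>{1..n div 2}. measure_pmf.prob ?M (\<Union>S\<in>?C k. ?E S))"
    by (rule measure_UNION_le) auto
  also have "\<dots> \<le> (\<Sum>k\<in>{1..n div 2}. \<Sum>S\<in>?C k. measure_pmf.prob ?M (?E S))"
    by (intro sum_mono measure_UNION_le) auto
  also have "\<dots> = (\<Sum>k\<in>{1..n div 2}. \<Sum>S\<in>?C k. (1 / (n choose k)) ^ d)"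
    by (intro sum.cong refl) (subst prob_random_permutations_all, subst prob_permutes_invariant, auto)
  also have "\<dots> = (\<Sum>k\<in>{1..n div 2}. (n choose k) * (1 / (n choose k)) ^ d)"
    using n_subsets[of "{1..n}"] by simp
  finally show ?thesis .
qed

text \<open>The constant is 31 = 4 + 27: the term \<open>k = 2\<close> is at most 4/n^2, and each of
  the at most n remaining terms is at most 27/n^3.\<close>

lemma sum_inverse_binomial_le:
  assumes "n \<ge> 6"
  shows "(\<Sum>k\<in>{2..n div 2}. 1 / real (n choose k)) \<le> 31 / real n ^ 2"
proof -
  have b2: "real n ^ 2 / 4 \<le> real (n choose 2)"
    using binomial_ge_n_over_k_pow_k[of 2 n, where 'a = real] assms by (simp add: power_divide)
  have b3: "real n ^ 3 / 27 \<le> real (n choose 3)"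
    using binomial_ge_n_over_k_pow_k[of 3 n, where 'a = real] assms by (simp add: power_divide)
  have "1 / real (n choose k) \<le> 27 / real n ^ 3" if "k \<in> {3..n div 2}" for k
  proof -
    \<comment> \<open>Binomial coefficients increase up to the middle, and \<open>k\<close> is at
      most \<open>n div 2\<close>.\<close>
    have "real (n choose 3) \<le> real (n choose k)"
      using that by (intro of_nat_mono binomial_mono) auto
    with b3 have "real n ^ 3 / 27 \<le> real (n choose k)" by linarith
    then have "1 / real (n choose k) \<le> 1 / (real n ^ 3 / 27)"
      using assms by (intro divide_left_mono) (use that in \<open>auto intro!: mult_pos_pos simp: zero_less_binomial_iff\<close>)
    then show ?thesis by simp
  qed
  then have "(\<Sum>k\<in>{3..n div 2}. 1 / real (n choose k)) \<le>
      real (card {3..n div 2}) * (27 / real n ^ 3)"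
    by (rule sum_bounded_above)
  also have "\<dots> \<le> real n * (27 / real n ^ 3)"
    by (intro mult_right_mono) auto
  also have "\<dots> = 27 / real n ^ 2"
    by (simp add: power2_eq_square power3_eq_cube)
  finally have tail: "(\<Sum>k\<in>{3..n div 2}. 1 / real (n choose k)) \<le> 27 / real n ^ 2" .
  have "1 / real (n choose 2) \<le> 1 / (real n ^ 2 / 4)"
    using b2 assms by (intro divide_left_mono) (auto intro!: mult_pos_pos)
  moreover have "{2..n div 2} = insert 2 {3..n div 2}"
    using assms by auto
  ultimately show ?thesis
    using tail by (simp add: add_divide_distrib[symmetric])
qed

text \<open>The union bound sums the powers of 1 / (n choose k) with exponent d - 1. The term
  \<open>k = 1\<close> is the main term. For larger \<open>k\<close>, all but one of the factors are
  bounded by 1/n, and the factor kept makes the sum O(1/n^2).\<close>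

lemma prob_disconnecting_upper:
  assumes "d \<ge> 2" "n \<ge> 6"
  shows "measure_pmf.prob (random_permutations d n) (disconnecting d n) \<le>
    1 / real n ^ (d - 1) + 31 / real n ^ d"
proof -
  \<comment> \<open>Here \<open>e\<close> is the number of factors that are bounded by 1/n when one
    of the \<open>d - 1\<close> factors is kept.\<close>
  obtain e where d: "d = e + 2" using assms(1) le_Suc_ex by (metis add.commute)
  have pos: "real (n choose k) > 0" if "k \<in> {1..n div 2}" for k
    using that by (auto simp: zero_less_binomial_iff)
  have tail: "(1 / real (n choose k)) ^ (e + 1) \<le> (1 / real n) ^ e * (1 / real (n choose k))"
    if "k \<in> {2..n div 2}" for k
  proof -
    have "n choose 1 \<le> n choose k"
      using that by (intro binomial_mono) auto
    then have "real n \<le> real (n choose k)" by simp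
    then have "(1 / real (n choose k)) ^ e \<le> (1 / real n) ^ e"
      using assms(2) by (intro power_mono divide_left_mono mult_pos_pos) (use that in auto)
    then show ?thesis
      by (simp add: mult_right_mono divide_right_mono)
  qed
  have "(\<Sum>k\<in>{1..n div 2}. (n choose k) * (1 / (n choose k)) ^ d) =
      (\<Sum>k\<in>{1..n div 2}. (1 / real (n choose k)) ^ (e + 1))"
    by (intro sum.cong refl) (use pos in \<open>auto simp: d\<close>)
  also have "\<dots> =
      (1 / real n) ^ (e + 1) + (\<Sum>k\<in>{2..n div 2}. (1 / real (n choose k)) ^ (e + 1))"
  proof -
    have "{1..n div 2} = insert 1 {2..n div 2}"
      using assms(2) by auto
    then show ?thesis by simp
  qed
  also have "\<dots> \<le> (1 / real n) ^ (e + 1) +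
      (\<Sum>k\<in>{2..n div 2}. (1 / real n) ^ e * (1 / real (n choose k)))"
    by (intro add_left_mono sum_mono tail)
  also have "\<dots> = (1 / real n) ^ (e + 1) +
      (1 / real n) ^ e * (\<Sum>k\<in>{2..n div 2}. 1 / real (n choose k))"
    by (simp add: sum_distrib_left)
  also have "\<dots> \<le> (1 / real n) ^ (e + 1) + (1 / real n) ^ e * (31 / real n ^ 2)"
    using assms(2) by (intro add_left_mono mult_left_mono sum_inverse_binomial_le) auto
  also have "\<dots> = 1 / real n ^ (d - 1) + 31 / real n ^ d"
    by (simp add: d power_divide power_add power2_eq_square)
  finally show ?thesis
    using prob_disconnecting_le[of n d] assms(2) by linarith
qed

section \<open>Lower bound on the probability of disconnection\<close>

text \<open>
  The events that \<open>x\<close> is the only isolated vertex are disjoint, and together they already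
  account for the main term.
\<close>

lemma prob_disconnecting_ge:
  assumes "n \<ge> 2"
  shows "measure_pmf.prob (random_permutations d n) (disconnecting d n) \<ge>
    real n * (1 / real n) ^ d -
    real n * (real n - 1) * (1 / (real n * (real n - 1))) ^ d"
proof -
  let ?M = "random_permutations d n" and ?V = "{1..n}"
  define A where "A x = {\<sigma> :: nat \<Rightarrow> nat \<Rightarrow> nat. \<forall>i\<in>{1..d}. \<sigma> i x = x}" for x
  \<comment> \<open>Removing \<open>A x \<inter> A y\<close> rather than \<open>A y\<close> keeps
    the removed set inside \<open>A x\<close>, so that the probabilities subtract exactly.\<close>
  define B where "B x = A x - (\<Union>y\<in>?V - {x}. A x \<inter> A y)" for x
  have A: "measure_pmf.prob ?M (A x) = (1 / real n) ^ d" if "x \<in> ?V" for x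
    \<comment> \<open>A fixed point is an invariant singleton, so the binomial formula yields 1/n
      per permutation.\<close>
    using that prob_random_permutations_all[of d n "{\<pi>. \<pi> ` {x} = {x}}"]
      prob_permutes_invariant[of ?V "{x}"]
    by (simp add: A_def)
  have AA: "measure_pmf.prob ?M (A x \<inter> A y) = (1 / (real n * (real n - 1))) ^ d"
    if "x \<in> ?V" "y \<in> ?V - {x}" for x y
  proof -
    have "A x \<inter> A y = {\<sigma>. \<forall>i\<in>{1..d}. \<sigma> i \<in> {\<pi>. \<pi> x = x \<and> \<pi> y = y}}"
      by (auto simp: A_def)
    then show ?thesis
      using that prob_permutes_fix_two[of ?V x y]
      by (simp only: prob_random_permutations_all) auto
  qed
  have B: "measure_pmf.prob ?M (B x) \<ge>
      (1 / real n) ^ d - (real n - 1) * (1 / (real n * (real n - 1))) ^ d" if x: "x \<in> ?V" for x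
  proof -
    have "measure_pmf.prob ?M (\<Union>y\<in>?V - {x}. A x \<inter> A y) \<le>
        (\<Sum>y\<in>?V - {x}. measure_pmf.prob ?M (A x \<inter> A y))"
      by (rule measure_UNION_le) auto
    also have "\<dots> = (real n - 1) * (1 / (real n * (real n - 1))) ^ d"
      using x assms by (simp add: AA of_nat_diff)
    finally have "measure_pmf.prob ?M (\<Union>y\<in>?V - {x}. A x \<inter> A y) \<le> \<dots>" .
    moreover have "measure_pmf.prob ?M (B x) =
        measure_pmf.prob ?M (A x) - measure_pmf.prob ?M (\<Union>y\<in>?V - {x}. A x \<inter> A y)"
      unfolding B_def by (rule measure_pmf.finite_measure_Diff) auto
    ultimately show ?thesis using A[OF x] by linarith
  qed
  have disj: "disjoint_family_on B ?V"
    by (auto simp: disjoint_family_on_def B_def)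
  have "real n * (1 / real n) ^ d - real n * (real n - 1) * (1 / (real n * (real n - 1))) ^ d =
      (\<Sum>x\<in>?V. (1 / real n) ^ d - (real n - 1) * (1 / (real n * (real n - 1))) ^ d)"
    by (simp add: algebra_simps)
  also have "\<dots> \<le> (\<Sum>x\<in>?V. measure_pmf.prob ?M (B x))"
    by (intro sum_mono B)
  also have "\<dots> = measure_pmf.prob ?M (\<Union>x\<in>?V. B x)"
    using disj by (intro measure_pmf.finite_measure_finite_Union[symmetric]) auto
  also have "\<dots> \<le> measure_pmf.prob ?M (disconnecting d n)"
  proof (intro measure_pmf.finite_measure_mono_AE)
    show "AE \<sigma> in ?M. \<sigma> \<in> (\<Union>x\<in>?V. B x) \<longrightarrow> \<sigma> \<in> disconnecting d n"
    proof (intro AE_pmfI impI)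
      fix \<sigma> assume s: "\<sigma> \<in> set_pmf ?M" and "\<sigma> \<in> (\<Union>x\<in>?V. B x)"
      then obtain x where x: "x \<in> ?V" "\<forall>i\<in>{1..d}. \<sigma> i ` {x} = {x}"
        by (auto simp: A_def B_def)
      \<comment> \<open>With at least two vertices, the invariant singleton is a proper subset and
        so witnesses disconnection.\<close>
      have "card {x} \<noteq> card ?V" using assms by simp
      then have "{x} \<noteq> ?V" by metis
      moreover have "{x} \<subseteq> ?V" using x(1) by blast
      ultimately have "\<not> (\<forall>S\<subseteq>?V. (\<forall>i\<in>{1..d}. \<sigma> i ` S = S) \<longrightarrow> S = {} \<or> S = ?V)"
        using x(2) by blast
      then show "\<sigma> \<in> disconnecting d n"
        unfolding disconnecting_def mem_Collect_eq
        by (subst connected_perm_multigraph_iff_invariant)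
          (use permutes_random_permutations[OF s] in auto)
    qed
  qed simp
  finally show ?thesis .
qed

text \<open>The correction for pairs equals (1/n)^(d-1) (1/(n-1))^(d-1). One factor 1/(n-1) is
  bounded by 2/n, since n - 1 is at least n/2, and the other such factors by 1.\<close>

lemma prob_disconnecting_lower:
  assumes "d \<ge> 2" "n \<ge> 2"
  shows "measure_pmf.prob (random_permutations d n) (disconnecting d n) \<ge>
    1 / real n ^ (d - 1) - 2 / real n ^ d"
proof -
  obtain e where d: "d = e + 2" using assms(1) le_Suc_ex by (metis add.commute)
  define q where "q = 1 / (real n - 1)"
  have q: "0 \<le> q" "q \<le> 1" "q \<le> 2 / real n"
    using assms(2) by (auto simp: q_def field_simps)
  have "real n * (real n - 1) * (1 / (real n * (real n - 1))) ^ d =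
      real n * (real n - 1) * ((1 / real n) * q) ^ d"
    by (simp add: q_def)
  also have "\<dots> = (real n * (1 / real n)) * ((real n - 1) * q) * ((1 / real n) ^ (e + 1) * (q ^ e * q))"
    by (simp add: d power_mult_distrib del: times_divide_eq_left times_divide_eq_right)
  also have "\<dots> = (1 / real n) ^ (e + 1) * (q ^ e * q)"
    using assms(2) by (simp add: q_def)
  also have "\<dots> \<le> (1 / real n) ^ (e + 1) * (1 * (2 / real n))"
    using q by (intro mult_left_mono mult_mono power_le_one) auto
  also have "\<dots> = 2 / real n ^ d"
    by (simp add: d power_divide)
  finally have "real n * (real n - 1) * (1 / (real n * (real n - 1))) ^ d \<le> 2 / real n ^ d" .
  moreover have "real n * (1 / real n) ^ d = 1 / real n ^ (d - 1)"
    using assms(2) by (simp add: d power_divide)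
  ultimately show ?thesis
    using prob_disconnecting_ge[OF assms(2), of d] by linarith
qed

section \<open>The asymptotic estimate\<close>

theorem theorem4p15:
  fixes d :: nat
  assumes "d \<ge> 1"
  shows "(\<lambda>n. measure_pmf.prob (random_regular_multigraph d n) {G. Digraph_Component.connected G}
            - (1 - 1 / real n ^ (d - 1))) \<in> O(\<lambda>n. 1 / real n ^ d)"
proof (rule bigoI[of _ 31], rule eventually_sequentiallyI[of 6])
  fix n :: nat assume n: "n \<ge> 6"
  let ?P = "measure_pmf.prob (random_regular_multigraph d n) {G. Digraph_Component.connected G}"
  \<comment> \<open>The constant 31 comes from the upper bound on disconnection; it also absorbs the
    2 of the lower bound and the 1 of the case \<open>d = 1\<close>.\<close>
  have "\<bar>?P - (1 - 1 / real n ^ (d - 1))\<bar> \<le> 31 / real n ^ d"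
  proof (cases "d = 1")
    case True
    have "?P \<le> 1 / real n"
      using prob_connected_one_le[of n] n True by simp
    also have "\<dots> \<le> 31 / real n" by (simp add: divide_right_mono)
    finally show ?thesis using True by simp
  next
    case False
    then have "d \<ge> 2" using assms by simp
    moreover have "2 / real n ^ d \<le> 31 / real n ^ d" by (simp add: divide_right_mono)
    ultimately show ?thesis
      using prob_disconnecting_upper[of d n] prob_disconnecting_lower[of d n] n
      unfolding prob_connected_eq abs_le_iff by linarith
  qed
  then show "norm (?P - (1 - 1 / real n ^ (d - 1))) \<le> 31 * norm (1 / real n ^ d)"
    by simp
qed

end
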